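(* Let $\|\cdot\|$ be a norm on $\mathbb{R}^m$ with dual norm $\|\cdot\|_*$. Let $Q\in\mathbb{R}^{n\times n}$ be symmetric positive definite, $A\in\mathbb{R}^{m\times n}$, $b\in\mathbb{R}^m$, $d\in\mathbb{R}^n$ and $\tau>0$. The unique solution of $$\min_{u\in\mathbb{R}^n}\ \tfrac12u^TQu-d^Tu+\tau\|Au+b\|$$ is $$u^*=Q^{-1}(d+A^Ty^* ),$$ where $y^*$ is a solution of $$\max_{y\in\mathbb{R}^m}\ -\tfrac12(d+A^Ty)^TQ^{-1}(d+A^Ty)-b^Ty\quad\text{subject to}\quad\|y\|_*\le\tau.$$ If $A$ has full row rank, $y^*$ is unique.
   Context: The dual norm is $\|y\|_*=\sup_{\|x\|\le1}x^Ty$. *)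

theory Defs
  imports "HOL-Analysis.Analysis"
begin

definition is_norm :: "('a::real_vector \<Rightarrow> real) \<Rightarrow> bool" where
  "is_norm N \<longleftrightarrow>
     (\<forall>x. 0 \<le> N x) \<and> (\<forall>x. N x = 0 \<longleftrightarrow> x = 0) \<and>
     (\<forall>c x. N (c *\<^sub>R x) = \<bar>c\<bar> * N x) \<and> (\<forall>x y. N (x + y) \<le> N x + N y)"

(* The supremum is taken in the reals. When N is a norm on a Euclidean space, its unit ball
   is nonempty and bounded, so this is the genuine supremum, not a default value. *)
definition dual_norm :: "('a::real_inner \<Rightarrow> real) \<Rightarrow> 'a \<Rightarrow> real" where
  "dual_norm N y = (SUP x\<in>{x. N x \<le> 1}. x \<bullet> y)"

definition sym_pos_def :: "real^'n^'n \<Rightarrow> bool" where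
  "sym_pos_def Q \<longleftrightarrow> transpose Q = Q \<and> (\<forall>x. x \<noteq> 0 \<longrightarrow> 0 < x \<bullet> (Q *v x))"

definition primal_objective ::
  "(real^'m \<Rightarrow> real) \<Rightarrow> real^'n^'n \<Rightarrow> real^'n^'m \<Rightarrow> real^'m \<Rightarrow> real^'n \<Rightarrow> real \<Rightarrow> real^'n \<Rightarrow> real"
where
  "primal_objective N Q A b d \<tau> u = 1/2 * (u \<bullet> (Q *v u)) - d \<bullet> u + \<tau> * N (A *v u + b)"

definition dual_objective ::
  "real^'n^'n \<Rightarrow> real^'n^'m \<Rightarrow> real^'m \<Rightarrow> real^'n \<Rightarrow> real^'m \<Rightarrow> real"
where
  "dual_objective Q A b d y =
     - (1/2) * ((d + transpose A *v y) \<bullet> (matrix_inv Q *v (d + transpose A *v y))) - b \<bullet> y"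

definition primal_solution ::
  "(real^'m \<Rightarrow> real) \<Rightarrow> real^'n^'n \<Rightarrow> real^'n^'m \<Rightarrow> real^'m \<Rightarrow> real^'n \<Rightarrow> real \<Rightarrow> real^'n \<Rightarrow> bool"
where
  "primal_solution N Q A b d \<tau> u \<longleftrightarrow> is_arg_min (primal_objective N Q A b d \<tau>) (\<lambda>_. True) u"

definition dual_solution ::
  "(real^'m \<Rightarrow> real) \<Rightarrow> real^'n^'n \<Rightarrow> real^'n^'m \<Rightarrow> real^'m \<Rightarrow> real^'n \<Rightarrow> real \<Rightarrow> real^'m \<Rightarrow> bool"
where
  "dual_solution N Q A b d \<tau> y \<longleftrightarrow>
     is_arg_max (dual_objective Q A b d) (\<lambda>y. dual_norm N y \<le> \<tau>) y"

end

theory Submission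
  imports Defs
begin

text \<open>
  The dual feasible set is compact, so a maximiser \<open>y\<close> exists. Put \<open>u = Q\<^sup>-\<^sup>1 (d + A\<^sup>T y)\<close> and
  \<open>w = A u + b\<close>. The gradient of the dual objective at \<open>y\<close> is \<open>-w\<close>, so first-order optimality
  says that \<open>-y\<close> maximises \<open>z \<bullet> w\<close> over \<open>\<parallel>z\<parallel>\<^sub>* \<le> \<tau>\<close>; as the norm is the support function of its
  dual ball (Hahn--Banach), \<open>-(y \<bullet> w) = \<tau> \<parallel>w\<parallel>\<close>. Hence the primal objective dominates the strictly
  convex quadratic \<open>v \<mapsto> v \<bullet> Q v / 2 - d \<bullet> v - y \<bullet> (A v + b)\<close>, with equality at its minimiser \<open>u\<close>.
  Thus \<open>u\<close> is the unique primal solution, and \<open>A\<^sup>T y\<close> is the same for all dual solutions.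
\<close>

section \<open>Norms on Euclidean space, dual norms and dual balls\<close>

lemma is_normD:
  assumes "is_norm N"
  shows "0 \<le> N x" "N x = 0 \<longleftrightarrow> x = 0" "N (c *\<^sub>R x) = \<bar>c\<bar> * N x" "N (x + y) \<le> N x + N y"
  using assms unfolding is_norm_def by auto

lemma is_norm_minus:
  assumes "is_norm N"
  shows "N (- x) = N x"
  using is_normD(3)[OF assms, of "-1" x] by simp

lemma is_norm_sum:
  assumes "is_norm N" "finite I"
  shows "N (\<Sum>i\<in>I. f i) \<le> (\<Sum>i\<in>I. N (f i))"
  using assms(2)
proof (induction I rule: finite_induct)
  case empty
  then show ?case using is_normD(2)[OF assms(1), of 0] by simp
next
  case (insert i I)
  then show ?case using is_normD(4)[OF assms(1), of "f i" "sum f I"] by simp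
qed

lemma is_norm_upper_bound:
  fixes N :: "'a::euclidean_space \<Rightarrow> real"
  assumes "is_norm N"
  obtains C where "C > 0" "\<And>x. N x \<le> C * norm x"
proof
  \<comment> \<open>Coordinates in the standard basis are bounded by \<open>norm x\<close>; the
    extra 1 makes the constant positive at once.\<close>
  let ?C = "1 + (\<Sum>i\<in>Basis. N (i::'a))"
  show "?C > 0"
    using is_normD(1)[OF assms] by (simp add: add_pos_nonneg sum_nonneg)
  fix x :: 'a
  have "N x = N (\<Sum>i\<in>Basis. (x \<bullet> i) *\<^sub>R i)"
    by (simp add: euclidean_representation)
  also have "\<dots> \<le> (\<Sum>i\<in>Basis. N ((x \<bullet> i) *\<^sub>R i))"
    by (rule is_norm_sum[OF assms]) simp
  also have "\<dots> = (\<Sum>i\<in>Basis. \<bar>x \<bullet> i\<bar> * N i)"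
    by (simp add: is_normD(3)[OF assms])
  also have "\<dots> \<le> (\<Sum>i\<in>Basis. norm x * N i)"
    by (intro sum_mono mult_right_mono Basis_le_norm is_normD(1)[OF assms])
  also have "\<dots> \<le> ?C * norm x"
    unfolding sum_distrib_left[symmetric] by (simp add: algebra_simps)
  finally show "N x \<le> ?C * norm x" .
qed

text \<open>The reverse triangle inequality and the bound by the Euclidean norm make
  \<open>N\<close> Lipschitz.\<close>

lemma is_norm_continuous:
  fixes N :: "'a::euclidean_space \<Rightarrow> real"
  assumes "is_norm N"
  shows "continuous_on S N"
proof -
  obtain C where C: "C > 0" "\<And>x. N x \<le> C * norm x"
    using is_norm_upper_bound[OF assms] by blast
  have "C-lipschitz_on S N"
  proof (rule lipschitz_onI)
    fix x y
    have "N x - N y \<le> N (x - y)" "N y - N x \<le> N (x - y)"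
      using is_normD(4)[OF assms, of "x - y" y] is_normD(4)[OF assms, of "y - x" x]
        is_norm_minus[OF assms, of "x - y"] by auto
    then show "dist (N x) (N y) \<le> C * dist x y"
      using C(2)[of "x - y"] by (auto simp: dist_norm)
  qed (use C in simp)
  then show ?thesis
    by (rule lipschitz_on_continuous_on)
qed

text \<open>By compactness \<open>N\<close> attains its minimum on the Euclidean unit sphere; the
  minimum is positive, and homogeneity extends the bound to all vectors.\<close>

lemma is_norm_lower_bound:
  fixes N :: "'a::euclidean_space \<Rightarrow> real"
  assumes "is_norm N"
  obtains m where "m > 0" "\<And>x. m * norm x \<le> N x"
proof -
  have "sphere (0::'a) 1 \<noteq> {}" by simp
  then obtain z where z: "norm z = 1" "\<And>x. norm x = 1 \<Longrightarrow> N z \<le> N x"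
    using continuous_attains_inf[OF compact_sphere _ is_norm_continuous[OF assms], of 0 1]
    by (auto simp: sphere_def dist_norm)
  show thesis
  proof
    have "z \<noteq> 0" using z(1) by auto
    then show "N z > 0"
      using is_normD(1,2)[OF assms, of z] by simp
    fix x
    show "N z * norm x \<le> N x"
    proof (cases "x = 0")
      case True
      then show ?thesis using is_normD(1)[OF assms] by simp
    next
      case False
      then have "N z \<le> N ((1 / norm x) *\<^sub>R x)" by (intro z) simp
      then show ?thesis using False by (simp add: is_normD(3)[OF assms] field_simps)
    qed
  qed
qed

text \<open>Homogeneity turns a bound over the unit ball into a Hoelder-type inequality. Dual
  feasibility thereby becomes a family of linear inequalities in \<open>y\<close>, and the supremum
  need not be handled again.\<close>

lemma dual_norm_le_iff:
  fixes N :: "'a::euclidean_space \<Rightarrow> real"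
  assumes "is_norm N" "r \<ge> 0"
  shows "dual_norm N y \<le> r \<longleftrightarrow> (\<forall>x. x \<bullet> y \<le> r * N x)"
proof -
  obtain m where m: "m > 0" "\<And>x. m * norm x \<le> N x"
    using is_norm_lower_bound[OF assms(1)] by blast
  \<comment> \<open>The unit ball of \<open>N\<close> lies in a Euclidean ball of radius
    \<open>1 / m\<close>, so the real supremum ranges over a bounded set, as
    \<open>cSUP_le_iff\<close> requires.\<close>
  have "x \<bullet> y \<le> norm y / m" if "N x \<le> 1" for x
  proof -
    have "norm x \<le> 1 / m" using m(1) m(2)[of x] that by (simp add: field_simps)
    then have "norm x * norm y \<le> 1 / m * norm y" by (intro mult_right_mono) auto
    then show ?thesis using norm_cauchy_schwarz[of x y] by simp
  qed
  then have bdd: "bdd_above ((\<lambda>x. x \<bullet> y) ` {x. N x \<le> 1})"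
    by (intro bdd_aboveI2) auto
  have "N 0 = 0" using is_normD(2)[OF assms(1)] by simp
  then have "{x. N x \<le> 1} \<noteq> {}" by (metis (mono_tags) empty_Collect_eq zero_le_one)
  then have "dual_norm N y \<le> r \<longleftrightarrow> (\<forall>x. N x \<le> 1 \<longrightarrow> x \<bullet> y \<le> r)"
    unfolding dual_norm_def using bdd by (subst cSUP_le_iff) auto
  also have "\<dots> \<longleftrightarrow> (\<forall>x. x \<bullet> y \<le> r * N x)"
  proof (intro iffI allI impI)
    fix x
    assume *: "\<forall>x. N x \<le> 1 \<longrightarrow> x \<bullet> y \<le> r"
    show "x \<bullet> y \<le> r * N x"
    proof (cases "x = 0")
      case True
      then show ?thesis using \<open>N 0 = 0\<close> by simp
    next
      case False
      then have "N x > 0" using is_normD(1,2)[OF assms(1), of x] by simp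
      moreover from this have "N ((1 / N x) *\<^sub>R x) \<le> 1" by (simp add: is_normD(3)[OF assms(1)])
      then have "((1 / N x) *\<^sub>R x) \<bullet> y \<le> r" using * by blast
      ultimately show ?thesis by (simp add: field_simps)
    qed
  next
    fix x
    assume le: "\<forall>x. x \<bullet> y \<le> r * N x" and x: "N x \<le> 1"
    have "x \<bullet> y \<le> r * N x" using le by blast
    also have "\<dots> \<le> r" using mult_left_mono[OF x assms(2)] by simp
    finally show "x \<bullet> y \<le> r" .
  qed
  finally show ?thesis .
qed

text \<open>Closed as an intersection of halfspaces; bounded by testing each \<open>y\<close>
  against itself.\<close>

lemma compact_dual_ball:
  fixes N :: "'a::euclidean_space \<Rightarrow> real"
  assumes "is_norm N" "r \<ge> 0"
  shows "compact {y. dual_norm N y \<le> r}"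
proof -
  obtain C where C: "C > 0" "\<And>x. N x \<le> C * norm x"
    using is_norm_upper_bound[OF assms(1)] by blast
  have eq: "{y. dual_norm N y \<le> r} = (\<Inter>x. {y. x \<bullet> y \<le> r * N x})"
    using dual_norm_le_iff[OF assms] by auto
  have "closed {y. dual_norm N y \<le> r}"
    unfolding eq by (intro closed_INT ballI closed_halfspace_le)
  moreover have "norm y \<le> r * C" if "dual_norm N y \<le> r" for y
  proof (cases "y = 0")
    case True
    then show ?thesis using C assms by simp
  next
    case False
    have "norm y * norm y = y \<bullet> y" by (simp add: norm_eq_sqrt_inner)
    also have "\<dots> \<le> r * N y" using that dual_norm_le_iff[OF assms] by blast
    also have "\<dots> \<le> r * (C * norm y)" by (intro mult_left_mono C assms)
    finally show ?thesis using False by simp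
  qed
  then have "bounded {y. dual_norm N y \<le> r}"
    by (auto intro: boundedI)
  ultimately show ?thesis by (simp add: compact_eq_bounded_closed)
qed

text \<open>Separate \<open>w\<close> from the open \<open>N\<close>-ball of radius
  \<open>N w\<close>. The normal of the hyperplane, rescaled to pair with \<open>w\<close> to
  \<open>N w\<close>, is a norming functional.\<close>

lemma dual_norm_attained:
  fixes N :: "'a::euclidean_space \<Rightarrow> real"
  assumes "is_norm N"
  obtains y where "dual_norm N y \<le> 1" "y \<bullet> w = N w"
proof (cases "w = 0")
  case True
  then show thesis
    using that[of 0] dual_norm_le_iff[OF assms, of 1 0] is_normD(1,2)[OF assms] by auto
next
  case False
  then have r: "N w > 0" using is_normD(1,2)[OF assms, of w] by simp
  let ?S = "{x. N x < N w}"
  have "convex ?S"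
  proof (rule convexI)
    fix x y and s t :: real
    assume *: "x \<in> ?S" "y \<in> ?S" "0 \<le> s" "0 \<le> t" "s + t = 1"
    have "N (s *\<^sub>R x + t *\<^sub>R y) \<le> s * N x + t * N y"
      using is_normD(4)[OF assms, of "s *\<^sub>R x" "t *\<^sub>R y"] * by (simp add: is_normD(3)[OF assms])
    also have "\<dots> < N w" using * by (intro convex_bound_lt) auto
    finally show "s *\<^sub>R x + t *\<^sub>R y \<in> ?S" by simp
  qed
  moreover have "0 \<in> ?S" using r is_normD(2)[OF assms, of 0] by simp
  ultimately obtain a c where a: "a \<noteq> 0" "\<forall>x\<in>?S. a \<bullet> x \<le> c" "\<forall>x\<in>{w}. c \<le> a \<bullet> x"
    using separating_hyperplane_sets[of ?S "{w}"] by auto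
  then have sep: "a \<bullet> x \<le> a \<bullet> w" if "N x < N w" for x
    using that by force
  have le: "N w * (a \<bullet> x) \<le> (a \<bullet> w) * N x" for x
  proof (cases "x = 0")
    case True
    then show ?thesis using is_normD(2)[OF assms, of 0] by simp
  next
    case False
    then have Nx: "N x > 0" using is_normD(1,2)[OF assms, of x] by simp
    \<comment> \<open>Rescaling \<open>x\<close> to \<open>N\<close>-length \<open>t * N w\<close>
      with \<open>t < 1\<close> puts it strictly inside the ball, where \<open>sep\<close> applies;
      the factor \<open>t\<close> is then removed.\<close>
    have "N w / N x * (a \<bullet> x) \<le> a \<bullet> w"
    proof (rule field_le_mult_one_interval)
      fix t :: real
      assume t: "0 < t" "t < 1"
      have "N ((t * N w / N x) *\<^sub>R x) = t * N w"
        using t r Nx by (simp add: is_normD(3)[OF assms])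
      also have "\<dots> < N w" using t r by simp
      finally have "a \<bullet> ((t * N w / N x) *\<^sub>R x) \<le> a \<bullet> w" by (rule sep)
      then show "t * (N w / N x * (a \<bullet> x)) \<le> a \<bullet> w" by (simp add: mult.assoc)
    qed
    then show ?thesis using Nx by (simp add: field_simps)
  qed
  \<comment> \<open>Testing \<open>le\<close> at the normal itself makes
    \<open>a \<bullet> w\<close> positive, so it can be divided by.\<close>
  have "0 < N w * (a \<bullet> a)" using r a by simp
  also have "\<dots> \<le> (a \<bullet> w) * N a" by (rule le)
  finally have aw: "a \<bullet> w > 0"
    using is_normD(1)[OF assms, of a] by (simp add: zero_less_mult_iff)
  show thesis
  proof
    have "x \<bullet> ((N w / (a \<bullet> w)) *\<^sub>R a) \<le> 1 * N x" for x
      using le[of x] aw by (simp add: field_simps inner_commute)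
    then show "dual_norm N ((N w / (a \<bullet> w)) *\<^sub>R a) \<le> 1"
      by (subst dual_norm_le_iff[OF assms]) auto
    show "((N w / (a \<bullet> w)) *\<^sub>R a) \<bullet> w = N w"
      using aw by simp
  qed
qed

section \<open>Adjoints and the inverse of a positive definite matrix\<close>

lemma inner_transpose_matrix_vector:
  fixes A :: "real^'n^'m"
  shows "(transpose A *v x) \<bullet> y = x \<bullet> (A *v y)"
  by (simp add: dot_lmul_matrix)

lemma sym_pos_def_inverse:
  assumes "sym_pos_def Q"
  shows "Q *v (matrix_inv Q *v x) = x"
proof -
  have "inj ((*v) Q)"
  proof (subst matrix_left_invertible_injective[symmetric], subst matrix_left_invertible_ker, intro allI impI)
    fix x
    assume "Q *v x = 0"
    then have "x \<bullet> (Q *v x) = 0" by simp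
    then show "x = 0" using assms unfolding sym_pos_def_def by force
  qed
  then have "invertible Q"
    by (simp add: invertible_left_inverse matrix_left_invertible_injective)
  \<comment> \<open>\<open>matrix_inv\<close> is defined by Hilbert choice, so it is a true inverse
    only once existence is known.\<close>
  then have "\<exists>B. Q ** B = mat 1 \<and> B ** Q = mat 1"
    unfolding invertible_def .
  then have "Q ** matrix_inv Q = mat 1"
    unfolding matrix_inv_def by (rule someI2_ex) blast
  then show ?thesis by (simp add: matrix_vector_mul_assoc)
qed

lemma sym_pos_def_inner_commute:
  assumes "sym_pos_def Q"
  shows "x \<bullet> (Q *v y) = (Q *v x) \<bullet> y"
  using assms inner_transpose_matrix_vector[of Q x y] unfolding sym_pos_def_def by simp

text \<open>Symmetry of \<open>Q\<close> at the preimages of \<open>x\<close> and \<open>y\<close>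
  gives symmetry of the inverse.\<close>

lemma sym_pos_def_inverse_inner_commute:
  assumes "sym_pos_def Q"
  shows "x \<bullet> (matrix_inv Q *v y) = (matrix_inv Q *v x) \<bullet> y"
  using sym_pos_def_inner_commute[OF assms, of "matrix_inv Q *v x" "matrix_inv Q *v y"]
  by (simp add: sym_pos_def_inverse[OF assms])

section \<open>The dual problem, its optimality condition and the passage to the primal\<close>

lemma dual_objective_expand:
  assumes "sym_pos_def Q"
  shows "dual_objective Q A b d (y + t *\<^sub>R h) = dual_objective Q A b d y
      - t * ((A *v (matrix_inv Q *v (d + transpose A *v y)) + b) \<bullet> h)
      - t\<^sup>2 / 2 * ((transpose A *v h) \<bullet> (matrix_inv Q *v (transpose A *v h)))"
proof -
  let ?P = "matrix_inv Q"
  define g where "g = d + transpose A *v y"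
  define k where "k = transpose A *v h"
  have g: "d + transpose A *v (y + t *\<^sub>R h) = g + t *\<^sub>R k"
    unfolding g_def k_def
    by (simp only: matrix_vector_right_distrib matrix_vector_mult_scaleR add.assoc)
  \<comment> \<open>Symmetry of the inverse merges the two cross terms of the quadratic
    form.\<close>
  have gk: "g \<bullet> (?P *v k) = k \<bullet> (?P *v g)"
    using sym_pos_def_inverse_inner_commute[OF assms, of g k] by (simp only: inner_commute)
  have kh: "k \<bullet> (?P *v g) = (A *v (?P *v g)) \<bullet> h"
    unfolding k_def inner_transpose_matrix_vector by (rule inner_commute)
  have "(g + t *\<^sub>R k) \<bullet> (?P *v (g + t *\<^sub>R k)) =
      g \<bullet> (?P *v g) + 2 * t * (k \<bullet> (?P *v g)) + t\<^sup>2 * (k \<bullet> (?P *v k))"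
    by (simp add: matrix_vector_right_distrib matrix_vector_mult_scaleR inner_add_left
        inner_add_right gk power2_eq_square distrib_left)
  then show ?thesis
    unfolding dual_objective_def g g_def[symmetric] k_def[symmetric] inner_add_left[of _ b]
      inner_add_right[of b] inner_scaleR_right kh
    by (simp add: field_simps)
qed

lemma continuous_on_dual_objective: "continuous_on S (dual_objective Q A b d)"
  unfolding dual_objective_def
  by (intro continuous_intros matrix_vector_mult_linear_continuous_on[THEN continuous_on_compose2]) auto

lemma dual_solution_exists:
  assumes "is_norm N" "\<tau> \<ge> 0"
  shows "\<exists>y. dual_solution N Q A b d \<tau> y"
proof -
  have "dual_norm N 0 \<le> \<tau>"
    using assms is_normD(1)[OF assms(1)] by (subst dual_norm_le_iff) auto
  then have "{y. dual_norm N y \<le> \<tau>} \<noteq> {}" by blast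
  from continuous_attains_sup[OF compact_dual_ball[OF assms] this continuous_on_dual_objective]
  show ?thesis
    unfolding dual_solution_def is_arg_max_linorder by blast
qed

text \<open>This is the variational inequality at a maximiser: by convexity the segment from
  \<open>y\<close> to \<open>z\<close> is feasible, so compare values at step \<open>t\<close>,
  divide by \<open>t\<close> and let \<open>t\<close> tend to 0 from the right.\<close>

lemma dual_solution_optimality:
  assumes "sym_pos_def Q" "is_norm N" "\<tau> \<ge> 0"
    and y: "dual_solution N Q A b d \<tau> y" and z: "dual_norm N z \<le> \<tau>"
  defines "w \<equiv> A *v (matrix_inv Q *v (d + transpose A *v y)) + b"
  shows "w \<bullet> y \<le> w \<bullet> z"
proof -
  let ?h = "z - y"
  \<comment> \<open>The coefficient of \<open>- t\<^sup>2\<close> in the exact expansion along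
    \<open>?h\<close>; it is independent of \<open>t\<close>, so \<open>t * c\<close> vanishes in
    the limit.\<close>
  define c where "c = (transpose A *v ?h) \<bullet> (matrix_inv Q *v (transpose A *v ?h)) / 2"
  have fy: "dual_norm N y \<le> \<tau>"
    and opt: "\<And>x. dual_norm N x \<le> \<tau> \<Longrightarrow> dual_objective Q A b d x \<le> dual_objective Q A b d y"
    using y unfolding dual_solution_def is_arg_max_linorder by auto
  have step: "- (w \<bullet> ?h) \<le> t * c" if t: "0 < t" "t < 1" for t
  proof -
    have "dual_norm N (y + t *\<^sub>R ?h) \<le> \<tau>"
    proof (subst dual_norm_le_iff[OF assms(2,3)], rule allI)
      fix x
      have "x \<bullet> y \<le> \<tau> * N x" "x \<bullet> z \<le> \<tau> * N x"
        using fy z by (simp_all add: dual_norm_le_iff[OF assms(2,3)])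
      then have "(1 - t) * (x \<bullet> y) + t * (x \<bullet> z) \<le> \<tau> * N x"
        using t by (intro convex_bound_le) auto
      then show "x \<bullet> (y + t *\<^sub>R ?h) \<le> \<tau> * N x"
        by (simp add: inner_add_right inner_diff_right algebra_simps)
    qed
    from opt[OF this] have "t * - (w \<bullet> ?h) \<le> t * (t * c)"
      unfolding dual_objective_expand[OF assms(1)] w_def[symmetric]
      by (simp add: c_def power2_eq_square)
    then show ?thesis using t by (simp only: mult_le_cancel_left_pos)
  qed
  have "((\<lambda>t. t * c) \<longlongrightarrow> 0 * c) (at_right 0)"
    by (intro tendsto_intros)
  moreover have "eventually (\<lambda>t. - (w \<bullet> ?h) \<le> t * c) (at_right 0)"
    unfolding eventually_at_right_field using step zero_less_one by blast
  ultimately have "- (w \<bullet> ?h) \<le> 0 * c"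
    by (rule tendsto_lowerbound) simp
  then show ?thesis by (simp add: inner_diff_right)
qed

text \<open>Completing the square of the quadratic minorant around \<open>u\<close> leaves exactly
  this remainder. Keeping it gives minimality and uniqueness together.\<close>

lemma dual_solution_primal_growth:
  assumes "is_norm N" "sym_pos_def Q" "\<tau> > 0" "dual_solution N Q A b d \<tau> y"
  defines "u \<equiv> matrix_inv Q *v (d + transpose A *v y)"
  shows "primal_objective N Q A b d \<tau> u + 1/2 * ((v - u) \<bullet> (Q *v (v - u)))
    \<le> primal_objective N Q A b d \<tau> v"
proof -
  define w where "w = A *v u + b"
  obtain z where z: "dual_norm N z \<le> 1" "z \<bullet> w = N w"
    using dual_norm_attained[OF assms(1)] by blast
  \<comment> \<open>The competitor for the optimality condition: the norming vector scaled to the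
    boundary value \<tau> and reflected, so that it pairs with \<open>w\<close> to
    \<open>- \<tau> * N w\<close>.\<close>
  have "dual_norm N (- (\<tau> *\<^sub>R z)) \<le> \<tau>"
  proof (subst dual_norm_le_iff[OF assms(1)])
    show "\<forall>x. x \<bullet> - (\<tau> *\<^sub>R z) \<le> \<tau> * N x"
    proof
      fix x
      have "(- x) \<bullet> z \<le> N x"
        using z(1) dual_norm_le_iff[OF assms(1), of 1 z] is_norm_minus[OF assms(1), of x]
        by (metis mult_1 zero_le_one)
      then show "x \<bullet> - (\<tau> *\<^sub>R z) \<le> \<tau> * N x"
        using assms(3) mult_left_mono[of "- (x \<bullet> z)" "N x" \<tau>] by simp
    qed
  qed (use assms in simp)
  from dual_solution_optimality[OF assms(2,1) _ assms(4) this] assms(3)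
  have "w \<bullet> y \<le> w \<bullet> (- (\<tau> *\<^sub>R z))"
    unfolding w_def u_def by simp
  then have tight: "\<tau> * N w \<le> - (y \<bullet> w)"
    using z(2) by (simp add: inner_commute)
  have "dual_norm N y \<le> \<tau>"
    using assms(4) unfolding dual_solution_def is_arg_max_linorder by simp
  then have bound: "- (y \<bullet> (A *v v + b)) \<le> \<tau> * N (A *v v + b)"
    using assms(1,3) dual_norm_le_iff[OF assms(1), of \<tau> y] is_norm_minus[OF assms(1)]
    by (metis inner_commute inner_minus_left less_imp_le)
  have "Q *v u = d + transpose A *v y"
    unfolding u_def by (rule sym_pos_def_inverse[OF assms(2)])
  \<comment> \<open>Stationarity of \<open>u\<close> turns the linear terms at \<open>u\<close> and
    \<open>v\<close> into pairings with \<open>Q *v u\<close>; linear arithmetic then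
    finishes.\<close>
  then have Qu: "x \<bullet> (Q *v u) = d \<bullet> x + y \<bullet> (A *v x)" for x
    by (simp only: inner_add_left inner_commute[of x] inner_transpose_matrix_vector)
  have uv: "u \<bullet> (Q *v v) = v \<bullet> (Q *v u)"
    by (simp only: sym_pos_def_inner_commute[OF assms(2), of u v] inner_commute)
  have "(v - u) \<bullet> (Q *v (v - u)) = v \<bullet> (Q *v v) - 2 * (v \<bullet> (Q *v u)) + u \<bullet> (Q *v u)"
    by (simp add: matrix_vector_mult_diff_distrib inner_diff_left inner_diff_right uv)
  with tight bound Qu[of u] Qu[of v] show ?thesis
    unfolding primal_objective_def w_def inner_add_right by argo
qed

text \<open>The growth term is positive away from \<open>?u\<close>. As an equivalence, this also
  forces all dual solutions to yield the same primal point.\<close>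

lemma dual_solution_primal_solution:
  assumes "is_norm N" "sym_pos_def Q" "\<tau> > 0" "dual_solution N Q A b d \<tau> y"
  shows "primal_solution N Q A b d \<tau> v \<longleftrightarrow> v = matrix_inv Q *v (d + transpose A *v y)"
    (is "_ \<longleftrightarrow> v = ?u")
proof -
  let ?p = "primal_objective N Q A b d \<tau>"
  have pos: "0 < (x - ?u) \<bullet> (Q *v (x - ?u))" if "x \<noteq> ?u" for x
    using assms(2) that unfolding sym_pos_def_def by (metis eq_iff_diff_eq_0)
  note growth = dual_solution_primal_growth[OF assms]
  have strict: "?p ?u < ?p x" if "x \<noteq> ?u" for x
    using growth[of x] pos[OF that] by linarith
  then have "?p ?u \<le> ?p x" for x
    by (cases "x = ?u") (auto intro: less_imp_le)
  moreover have "v = ?u" if "?p v \<le> ?p ?u"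
    using strict[of v] that by (meson not_less)
  ultimately show ?thesis
    unfolding primal_solution_def is_arg_min_linorder by auto
qed

theorem theorem5p1:
  fixes N :: "real^'m \<Rightarrow> real"
    and Q :: "real^'n^'n"
    and A :: "real^'n^'m"
    and b :: "real^'m"
    and d :: "real^'n"
    and \<tau> :: real
  assumes "is_norm N"
    and "sym_pos_def Q"
    and "\<tau> > 0"
  shows "(\<exists>!u. primal_solution N Q A b d \<tau> u) \<and>
         (\<exists>y. dual_solution N Q A b d \<tau> y) \<and>
         (\<forall>y. dual_solution N Q A b d \<tau> y \<longrightarrow>
            primal_solution N Q A b d \<tau> (matrix_inv Q *v (d + transpose A *v y))) \<and>
         (rank A = CARD('m) \<longrightarrow> (\<exists>!y. dual_solution N Q A b d \<tau> y))"
proof -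
  note primal = dual_solution_primal_solution[OF assms]
  obtain y where y: "dual_solution N Q A b d \<tau> y"
    using dual_solution_exists[OF assms(1), of \<tau>] assms(3) by (meson less_imp_le)
  have unique: "z = y" if "rank A = CARD('m)" "dual_solution N Q A b d \<tau> z" for z
  proof -
    have "matrix_inv Q *v (d + transpose A *v z) = matrix_inv Q *v (d + transpose A *v y)"
      using primal[OF y] primal[OF that(2)] by blast
    then have "d + transpose A *v z = d + transpose A *v y"
      by (metis sym_pos_def_inverse[OF assms(2)])
    then have "transpose A *v z = transpose A *v y"
      by (rule add_left_imp_eq)
    \<comment> \<open>Full row rank of \<open>A\<close> is full column rank of its transpose, hence
      injectivity.\<close>
    moreover have "inj ((*v) (transpose A))"
      using that(1) by (simp only: full_rank_injective[symmetric] rank_transpose)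
    ultimately show "z = y" by (simp only: inj_eq)
  qed
  have "\<exists>!u. primal_solution N Q A b d \<tau> u"
    unfolding primal[OF y] by simp
  moreover have "\<forall>z. dual_solution N Q A b d \<tau> z \<longrightarrow>
      primal_solution N Q A b d \<tau> (matrix_inv Q *v (d + transpose A *v z))"
    using primal by blast
  moreover have "rank A = CARD('m) \<longrightarrow> (\<exists>!z. dual_solution N Q A b d \<tau> z)"
    using y unique by blast
  ultimately show ?thesis
    using y by blast
qed

end
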